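(* Let $0<q<1$, let $N\ge1$ be an integer and let $\gamma,\delta$ be real with either $0<\gamma q<1$, $0<\delta q<1$, or $\gamma>q^{-N}$, $\delta>q^{-N}$. Let $a,b,\beta\in\mathbb R$ be defined by $b-a=N+1$, $q^\beta=\gamma$, $q^{2a}=\gamma\delta$, and put $C_n=(\gamma\delta q)^{n/2}\kappa_q^{2n}$, $x(s)=q^{-s}+\gamma\delta q^{s+1}$. Let $\beta_n,\gamma_n$ be the coefficients of the three-term recurrence relation $\mu(s)u_n^{\alpha,\beta}(s)_q=u_{n+1}^{\alpha,\beta}(s)_q+\beta_nu_n^{\alpha,\beta}(s)_q+\gamma_nu_{n-1}^{\alpha,\beta}(s)_q$ of the non-standard $q$-Racah polynomials. Then in the limit $q^\alpha\to0$ (real $\alpha\to+\infty$) this relation transforms into the three-term recurrence relation of the monic dual $q$-Hahn polynomials $R_n(s)_q=R_n(x(s),\gamma,\delta,N;q)$: for $0\le n\le N-1$ and $s=0,\dots,N$, $$x(s)R_n(s)_q=R_{n+1}(s)_q+\widetilde\beta_nR_n(s)_q+\widetilde\gamma_nR_{n-1}(s)_q,$$ where $$\widetilde\beta_n=\lim_{q^\alpha\to0}\frac{q^{a+1}}{c_1}[\beta_n-c_3]=1+\gamma\delta q-(1-\gamma q^{n+1})(1-q^{n-N})-\gamma q(\delta-q^{n-N-1})(1-q^n),$$ $$\widetilde\gamma_n=\lim_{q^\alpha\to0}\frac{q^{a+1}}{c_1}\frac{C_n}{C_{n-1}}\gamma_n=\gamma q(1-q^n)(\delta-q^{n-N-1})(1-q^{n-N-1})(1-\gamma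 q^n)$$ (the second limit for $n\ge1$).
   Context: Notation. $0<q<1$, $q^z=e^{z\log q}$. $(x;q)_k=\prod_{i=0}^{k-1}(1-xq^i)$, $(x_1,\dots,x_r;q)_k=\prod_j(x_j;q)_k$; ${}_r\varphi_{r-1}$ is the standard basic hypergeometric series. $\kappa_q=q^{1/2}-q^{-1/2}$; $[s]_q=\dfrac{q^{s/2}-q^{-s/2}}{q^{1/2}-q^{-1/2}}$. Lattice: $\mu(s)=[s]_q[s+1]_q=c_1(q^s+q^{-s-1})+c_3$ with $c_1=q^{1/2}\kappa_q^{-2}$, $c_3=-q^{-1/2}(1+q)\kappa_q^{-2}$. Non-standard monic $q$-Racah polynomials: $$u_n^{\alpha,\beta}(s)_q=q^{-\frac n2(2a+1)}\frac{(q^{a-b+1},q^{\beta+1},q^{a+b+\alpha+1};q)_n}{\kappa_q^{2n}(q^{\alpha+\beta+n+1};q)_n}\;{}_4\varphi_3\!\left(\begin{matrix}q^{-n},q^{\alpha+\beta+n+1},q^{a-s},q^{a+s+1}\\ q^{a-b+1},q^{\beta+1},q^{a+b+\alpha+1}\end{matrix}\Big|\,q,q\right),$$ with recurrence coefficients $$\beta_n=[a]_q[a+1]_q-\frac{[\alpha+\beta+n+1]_q[a-b+n+1]_q[\beta+n+1]_q[a+b+\alpha+n+1]_q}{[\alpha+\beta+2n+1]_q[\alpha+\beta+2n+2]_q}-\frac{[\alpha+n]_q[b-a+\alpha+\beta+n]_q[-a-b+\beta+n]_q[n]_q}{[\alpha+\beta+2n]_q[\alpha+\beta+2n+1]_q},$$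 $$\gamma_n=\frac{[n]_q[\alpha+\beta+n]_q[\alpha+n]_q[\beta+n]_q[b-a+\alpha+\beta+n]_q[-a-b+\beta+n]_q[a-b+n]_q[a+b+\alpha+n]_q}{[\alpha+\beta+2n-1]_q([\alpha+\beta+2n]_q)^2[\alpha+\beta+2n+1]_q}.$$ (The coefficient $\gamma_n$, with subscript, is not to be confused with the parameter $\gamma$.) Monic dual $q$-Hahn polynomials: $$R_n(x(s),\gamma,\delta,N;q)=(\gamma q,q^{-N};q)_n\;{}_3\varphi_2\!\left(\begin{matrix}q^{-n},q^{-s},\gamma\delta q^{s+1}\\ \gamma q,q^{-N}\end{matrix}\Big|\,q,q\right).$$ Convention: $u_{-1}=R_{-1}=0$. *)

theory Defs
  imports Complex_Main
begin

section \<open>Basic hypergeometric series\<close>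

definition qpoch :: "real \<Rightarrow> real \<Rightarrow> nat \<Rightarrow> real" where
  "qpoch x q k = (\<Prod>i<k. 1 - x * q ^ i)"

definition qpochs :: "real list \<Rightarrow> real \<Rightarrow> nat \<Rightarrow> real" where
  "qpochs xs q k = (\<Prod>x\<leftarrow>xs. qpoch x q k)"

text \<open>
  The series with \<open>r\<close> upper and \<open>r - 1\<close> lower parameters.  In a terminating series with an upper
  parameter \<open>q powr (-n)\<close> and a lower parameter \<open>q powr (-N)\<close>, where \<open>n \<le> N\<close>, the terms with
  index greater than \<open>n\<close> have numerator zero, and hence are zero (also where the denominator
  vanishes, as \<open>x / 0 = 0\<close>), which is the usual convention.
\<close>

definition basic_hypergeom :: "real list \<Rightarrow> real list \<Rightarrow> real \<Rightarrow> real \<Rightarrow> real" where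
  "basic_hypergeom as bs q z =
     (\<Sum>k. qpochs as q k / (qpochs bs q k * qpoch q q k) * z ^ k)"


section \<open>The lattice\<close>

definition kappa :: "real \<Rightarrow> real" where
  "kappa q = q powr (1/2) - q powr (-1/2)"

definition qbr :: "real \<Rightarrow> real \<Rightarrow> real" where
  "qbr q s = (q powr (s/2) - q powr (-s/2)) / (q powr (1/2) - q powr (-1/2))"

definition mu :: "real \<Rightarrow> real \<Rightarrow> real" where
  "mu q s = qbr q s * qbr q (s + 1)"

definition c1 :: "real \<Rightarrow> real" where
  "c1 q = q powr (1/2) / (kappa q)\<^sup>2"

definition c3 :: "real \<Rightarrow> real" where
  "c3 q = - (q powr (-1/2)) * (1 + q) / (kappa q)\<^sup>2"

lemma mu_eq:
  assumes "0 < q"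
  shows "mu q s = c1 q * (q powr s + q powr (- s - 1)) + c3 q"
proof -
  define r A where "r = q powr (1/2)" and "A = q powr (s/2)"
  have pos: "r > 0" "A > 0"
    using assms by (simp_all add: r_def A_def)
  have q: "q = r\<^sup>2"
    using assms by (simp add: r_def power2_eq_square flip: powr_add)
  have e: "q powr (-1/2) = 1 / r" "q powr (-s/2) = 1 / A"
      "q powr ((s+1)/2) = A * r" "q powr (-(s+1)/2) = 1 / (A * r)"
      "q powr s = A\<^sup>2" "q powr (- s - 1) = 1 / (A\<^sup>2 * r\<^sup>2)"
    using assms unfolding r_def A_def
    by (simp_all add: power2_eq_square add_divide_distrib diff_divide_distrib
          powr_minus_divide flip: powr_add)
      (simp_all add: powr_add powr_diff powr_minus_divide)
  have "(A - 1/A) * (A*r - 1/(A*r)) = r * (A\<^sup>2 + 1/(A\<^sup>2 * r\<^sup>2)) - (1/r) * (1 + r\<^sup>2)"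
    using pos by (simp add: field_simps power2_eq_square)
  moreover have "X / K\<^sup>2 = r * Y / K\<^sup>2 - (1/r) * (1 + r\<^sup>2) / K\<^sup>2"
    if "X = r * Y - (1/r) * (1 + r\<^sup>2)" for X Y K :: real
    using that by (simp only: diff_divide_distrib)
  ultimately show ?thesis
    unfolding mu_def qbr_def c1_def c3_def kappa_def e r_def[symmetric] A_def[symmetric]
    by (simp add: q power2_eq_square)
qed


section \<open>Non-standard monic q-Racah polynomials\<close>

definition qRacah :: "real \<Rightarrow> real \<Rightarrow> real \<Rightarrow> real \<Rightarrow> real \<Rightarrow> nat \<Rightarrow> real \<Rightarrow> real" where
  "qRacah q a b \<alpha> \<beta> n s =
     q powr (- (real n / 2) * (2 * a + 1))
     * qpochs [q powr (a - b + 1), q powr (\<beta> + 1), q powr (a + b + \<alpha> + 1)] q n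
     / (kappa q ^ (2 * n) * qpoch (q powr (\<alpha> + \<beta> + real n + 1)) q n)
     * basic_hypergeom
         [q powr (- real n), q powr (\<alpha> + \<beta> + real n + 1), q powr (a - s), q powr (a + s + 1)]
         [q powr (a - b + 1), q powr (\<beta> + 1), q powr (a + b + \<alpha> + 1)] q q"

definition qRacah_beta :: "real \<Rightarrow> real \<Rightarrow> real \<Rightarrow> real \<Rightarrow> real \<Rightarrow> nat \<Rightarrow> real" where
  "qRacah_beta q a b \<alpha> \<beta> n =
     qbr q a * qbr q (a + 1)
     - qbr q (\<alpha> + \<beta> + real n + 1) * qbr q (a - b + real n + 1)
         * qbr q (\<beta> + real n + 1) * qbr q (a + b + \<alpha> + real n + 1)
       / (qbr q (\<alpha> + \<beta> + 2 * real n + 1) * qbr q (\<alpha> + \<beta> + 2 * real n + 2))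
     - qbr q (\<alpha> + real n) * qbr q (b - a + \<alpha> + \<beta> + real n)
         * qbr q (- a - b + \<beta> + real n) * qbr q (real n)
       / (qbr q (\<alpha> + \<beta> + 2 * real n) * qbr q (\<alpha> + \<beta> + 2 * real n + 1))"

definition qRacah_gamma :: "real \<Rightarrow> real \<Rightarrow> real \<Rightarrow> real \<Rightarrow> real \<Rightarrow> nat \<Rightarrow> real" where
  "qRacah_gamma q a b \<alpha> \<beta> n =
     qbr q (real n) * qbr q (\<alpha> + \<beta> + real n) * qbr q (\<alpha> + real n) * qbr q (\<beta> + real n)
       * qbr q (b - a + \<alpha> + \<beta> + real n) * qbr q (- a - b + \<beta> + real n)
       * qbr q (a - b + real n) * qbr q (a + b + \<alpha> + real n)
     / (qbr q (\<alpha> + \<beta> + 2 * real n - 1) * (qbr q (\<alpha> + \<beta> + 2 * real n))\<^sup>2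
       * qbr q (\<alpha> + \<beta> + 2 * real n + 1))"


section \<open>Monic dual q-Hahn polynomials\<close>

text \<open>
  If \<open>q powr (2 * a) = \<gamma> * \<delta>\<close>, then
  \<open>mu q (s + a) = c1 q * q powr (- a - 1) * dqHahn_x q \<gamma> \<delta> s + c3 q\<close> by \<open>mu_eq\<close>: the variable \<open>s\<close> of
  the dual q-Hahn polynomials corresponds to \<open>s + a\<close> in the q-Racah polynomials.
\<close>

definition dqHahn_x :: "real \<Rightarrow> real \<Rightarrow> real \<Rightarrow> real \<Rightarrow> real" where
  "dqHahn_x q \<gamma> \<delta> s = q powr (- s) + \<gamma> * \<delta> * q powr (s + 1)"

definition dqHahn :: "real \<Rightarrow> real \<Rightarrow> real \<Rightarrow> nat \<Rightarrow> nat \<Rightarrow> real \<Rightarrow> real" where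
  "dqHahn q \<gamma> \<delta> N n s =
     qpochs [\<gamma> * q, q powr (- real N)] q n
     * basic_hypergeom
         [q powr (- real n), q powr (- s), \<gamma> * \<delta> * q powr (s + 1)]
         [\<gamma> * q, q powr (- real N)] q q"

definition dqHahn_beta :: "real \<Rightarrow> real \<Rightarrow> real \<Rightarrow> nat \<Rightarrow> nat \<Rightarrow> real" where
  "dqHahn_beta q \<gamma> \<delta> N n =
     1 + \<gamma> * \<delta> * q
     - (1 - \<gamma> * q ^ (n + 1)) * (1 - q powr (real n - real N))
     - \<gamma> * q * (\<delta> - q powr (real n - real N - 1)) * (1 - q ^ n)"

definition dqHahn_gamma :: "real \<Rightarrow> real \<Rightarrow> real \<Rightarrow> nat \<Rightarrow> nat \<Rightarrow> real" where
  "dqHahn_gamma q \<gamma> \<delta> N n =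
     \<gamma> * q * (1 - q ^ n) * (\<delta> - q powr (real n - real N - 1))
     * (1 - q powr (real n - real N - 1)) * (1 - \<gamma> * q ^ n)"

definition norm_C :: "real \<Rightarrow> real \<Rightarrow> real \<Rightarrow> nat \<Rightarrow> real" where
  "norm_C q \<gamma> \<delta> n = (\<gamma> * \<delta> * q) powr (real n / 2) * kappa q ^ (2 * n)"

text \<open>
  The sequence shifted down by one index, with the convention that its member with index \<open>-1\<close>
  is zero.
\<close>

definition prev :: "(nat \<Rightarrow> real) \<Rightarrow> nat \<Rightarrow> real" where
  "prev f n = (case n of 0 \<Rightarrow> 0 | Suc m \<Rightarrow> f m)"

end

theory Submission
  imports Defs
begin

text \<open>
  Rescaled by \<open>norm_C\<close> and taken at \<open>s + a\<close>, the non-standard q-Racah polynomials are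
  \<open>P\<^sub>n = lead\<^sub>n * (\<Sum>k\<le>n. e\<^sub>n\<^sub>k * \<phi>\<^sub>k)\<close> in the basis \<open>\<phi>\<^sub>k = (q\<^sup>-\<^sup>s, \<gamma> \<delta> q\<^sup>s\<^sup>+\<^sup>1; q)\<^sub>k\<close>, in which
  \<open>x(s) * \<phi>\<^sub>k\<close> is a combination of \<open>\<phi>\<^sub>k\<close> and \<open>\<phi>\<^sub>k\<^sub>+\<^sub>1\<close>.  The differences \<open>e\<^sub>n\<^sub>+\<^sub>1\<^sub>,\<^sub>k - e\<^sub>n\<^sub>k\<close> factorise,
  which reduces the recurrence to one polynomial identity in \<open>q\<^sup>n\<close> and \<open>q\<^sup>k\<close>.  Its coefficients
  are \<open>1 + \<gamma> \<delta> q - up\<^sub>n - down\<^sub>n\<close> and \<open>up\<^sub>n\<^sub>-\<^sub>1 * down\<^sub>n\<close>.  All quantities are rational in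
  \<open>q\<^sup>\<alpha>\<close> and regular at \<open>q\<^sup>\<alpha> = 0\<close>, so the dual q-Hahn recurrence follows by uniqueness of limits.
\<close>

section \<open>The q-Racah recurrence\<close>

lemma qpoch_0 [simp]: "qpoch x q 0 = 1"
  by (simp add: qpoch_def)

lemma qpoch_Suc: "qpoch x q (Suc k) = qpoch x q k * (1 - x * q ^ k)"
  by (simp add: qpoch_def)

lemma qpoch_Suc_shift: "qpoch x q (Suc k) = (1 - x) * qpoch (x * q) q k"
  unfolding qpoch_def by (subst prod.lessThan_Suc_shift) (simp add: mult.assoc)

lemma qpoch_nonzero: "(\<And>i. i < k \<Longrightarrow> x * q ^ i \<noteq> 1) \<Longrightarrow> qpoch x q k \<noteq> 0"
  by (auto simp: qpoch_def)

text \<open>Powers of \<open>q\<close> only shrink a positive \<open>x\<close>, and a nonpositive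
  \<open>x\<close> stays below \<open>c\<close>. With \<open>c\<close> equal to \<open>1\<close> or
  \<open>q\<close> this keeps the denominators \<open>1 - E * q ^ m\<close> and
  \<open>1 - E * q ^ m / q\<close> away from zero.\<close>

lemma mult_power_less:
  fixes q x c :: real
  assumes q: "0 < q" "q < 1" and "x < c" "0 < c"
  shows "x * q ^ n < c"
proof (cases "x > 0")
  case True
  have "x * q ^ n \<le> x * 1" using q True by (intro mult_left_mono) (auto simp: power_le_one)
  then show ?thesis using assms by simp
next
  case False
  then have "x * q ^ n \<le> 0" using q by (simp add: mult_nonpos_nonneg)
  then show ?thesis using assms by simp
qed

lemma qpoch_nonzero_lt_1:
  assumes "0 < q" "q < 1" "x < 1"
  shows "qpoch x q k \<noteq> 0"
  using mult_power_less[OF assms zero_less_one] by (intro qpoch_nonzero) (metis less_irrefl)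

text \<open>The factor with index \<open>n\<close> is zero; this terminates every series with upper
  parameter \<open>1 / q ^ n\<close>.\<close>

lemma qpoch_inverse_power_eq_0:
  assumes "q \<noteq> 0" "n < k"
  shows "qpoch (1 / q ^ n) q k = 0"
  using assms by (auto simp: qpoch_def intro!: bexI[of _ n])

text \<open>
  In terms of the classical q-Racah parameters \<open>\<alpha>, \<beta>, \<gamma>, \<delta>\<close> one has \<open>A = \<alpha> q\<close>, \<open>B = \<beta> \<delta> q\<close>,
  \<open>D = \<gamma> q\<close>, \<open>E = \<alpha> \<beta> q\<close>; the balancing condition is \<open>w * q\<^sup>2 * E = A * B * D\<close> with
  \<open>w = \<gamma> \<delta>\<close>.
\<close>

definition racah_term :: "real \<Rightarrow> real \<Rightarrow> real \<Rightarrow> real \<Rightarrow> real \<Rightarrow> nat \<Rightarrow> nat \<Rightarrow> real" where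
  "racah_term q A B D E n k =
     qpoch (1 / q ^ n) q k * qpoch (E * q ^ n) q k
     / (qpoch A q k * qpoch B q k * qpoch D q k * qpoch q q k) * q ^ k"

text \<open>Under the dictionary above, \<open>racah_up\<close> and \<open>racah_down\<close> are
  the coefficients usually called A_n and C_n in the recurrence of the classical q-Racah
  polynomials.\<close>

definition racah_up :: "real \<Rightarrow> real \<Rightarrow> real \<Rightarrow> real \<Rightarrow> real \<Rightarrow> nat \<Rightarrow> real" where
  "racah_up q A B D E n =
     (1 - E * q ^ n) * (1 - A * q ^ n) * (1 - B * q ^ n) * (1 - D * q ^ n)
     / ((1 - E * q ^ (2 * n)) * (1 - E * q ^ (2 * n + 1)))"

definition racah_down :: "real \<Rightarrow> real \<Rightarrow> real \<Rightarrow> real \<Rightarrow> real \<Rightarrow> nat \<Rightarrow> real" where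
  "racah_down q A B D E n =
     A * B * D / (E * q) * (1 - q ^ n) * (1 - E * q ^ n / A) * (1 - E * q ^ n / B)
       * (1 - E * q ^ n / D)
     / ((1 - E * q ^ (2 * n) / q) * (1 - E * q ^ (2 * n)))"

text \<open>What remains of the recurrence at one basis element once common factors are removed,
  with \<open>Q\<close> for \<open>q ^ n\<close>, \<open>J\<close> for \<open>q ^ j\<close> and
  \<open>V\<close> for \<open>w * q\<^sup>2\<close>. Clearing denominators leaves a polynomial
  identity modulo the balancing relation.\<close>

lemma racah_core_identity:
  fixes A B D E J Q V :: real
  assumes V: "V * E = A * B * D"
    and nz: "A \<noteq> 0" "B \<noteq> 0" "D \<noteq> 0" "E \<noteq> 0" "J \<noteq> 0" "Q \<noteq> 0" "1 - E * Q\<^sup>2 \<noteq> 0"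
  shows "((1 - V * J) * (1 - J / Q) * (1 - E * Q * J) - (1 - A * J) * (1 - B * J) * (1 - D * J)) / J
    = - ((1 - A * Q) * (1 - B * Q) * (1 - D * Q) * (1 - E * Q * J) / (Q * (1 - E * Q\<^sup>2)))
      - V * (1 - J / Q) * (1 - E * Q / A) * (1 - E * Q / B) * (1 - E * Q / D) / (1 - E * Q\<^sup>2)"
proof -
  \<comment> \<open>\<open>W\<close> is the expanded product in \<open>W\<close> below after
    \<open>A * B * D\<close> is replaced by \<open>V * E\<close>; no division by \<open>A\<close>,
    \<open>B\<close> or \<open>D\<close> is left.\<close>
  define W where "W = V - Q * (B * D + A * D + A * B) + E * Q\<^sup>2 * (A + B + D) - E\<^sup>2 * Q ^ 3"
  have V': "V = A * B * D / E" using V nz by (simp add: field_simps)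
  have W: "V * (1 - E * Q / A) * (1 - E * Q / B) * (1 - E * Q / D) = W"
    unfolding W_def V' using nz by (simp add: field_simps power2_eq_square power3_eq_cube)
  have poly: "((1 - V * J) * (Q - J) * (1 - E * Q * J) - Q * (1 - A * J) * (1 - B * J) * (1 - D * J))
      * (1 - E * Q\<^sup>2)
    = - (J * (1 - A * Q) * (1 - B * Q) * (1 - D * Q) * (1 - E * Q * J)) - J * (Q - J) * W"
    unfolding W_def using V by algebra
  define U where "U = 1 - E * Q\<^sup>2"
  have U: "U \<noteq> 0" using nz by (simp add: U_def)
  have "((1 - V * J) * (1 - J / Q) * (1 - E * Q * J) - (1 - A * J) * (1 - B * J) * (1 - D * J)) / J
    = ((1 - V * J) * (Q - J) * (1 - E * Q * J) - Q * (1 - A * J) * (1 - B * J) * (1 - D * J))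
      * U / (J * Q * U)"
    using nz U by (simp add: divide_simps)
  also have "\<dots> = - ((1 - A * Q) * (1 - B * Q) * (1 - D * Q) * (1 - E * Q * J) / (Q * U))
      - (1 - J / Q) * W / U"
    unfolding poly[folded U_def] using nz U by (simp add: divide_simps) (simp add: algebra_simps)
  finally show ?thesis
    using W unfolding U_def by (simp add: mult_ac)
qed

text \<open>\<open>F\<close> is a common factor of all neighbouring terms. The factor
  \<open>1 - E * q ^ n\<close> stays on the left, where the numerator of \<open>racah_up\<close>
  will supply it.\<close>

lemma racah_term_Suc:
  assumes q: "0 < q" "q < 1"
    and nz: "qpoch A q (Suc j) \<noteq> 0" "qpoch B q (Suc j) \<noteq> 0" "qpoch D q (Suc j) \<noteq> 0"
    and F: "F = qpoch (1 / q ^ n) q j * qpoch (E * q ^ n) q j * q ^ j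
      / (qpoch A q (Suc j) * qpoch B q (Suc j) * qpoch D q (Suc j) * qpoch q q (Suc j))"
  shows "racah_term q A B D E n (Suc j) = F * q * (1 - q ^ j / q ^ n) * (1 - E * q ^ n * q ^ j)"
    and "racah_term q A B D E n j
      = F * (1 - A * q ^ j) * (1 - B * q ^ j) * (1 - D * q ^ j) * (1 - q * q ^ j)"
    and "(1 - E * q ^ n) * racah_term q A B D E (Suc n) (Suc j)
      = F * q * (1 - 1 / (q * q ^ n)) * (1 - E * q ^ n * q ^ j) * (1 - E * q ^ n * q ^ j * q)"
proof -
  have nq: "qpoch q q (Suc j) \<noteq> 0" using q by (intro qpoch_nonzero_lt_1) auto
  show "racah_term q A B D E n (Suc j) = F * q * (1 - q ^ j / q ^ n) * (1 - E * q ^ n * q ^ j)"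
    unfolding racah_term_def F by (simp add: qpoch_Suc[of "1 / q ^ n"] qpoch_Suc[of "E * q ^ n"])
  show "racah_term q A B D E n j
      = F * (1 - A * q ^ j) * (1 - B * q ^ j) * (1 - D * q ^ j) * (1 - q * q ^ j)"
    using nz nq unfolding racah_term_def F by (simp add: qpoch_Suc)
  have 1: "qpoch (1 / q ^ Suc n) q (Suc j) = (1 - 1 / (q * q ^ n)) * qpoch (1 / q ^ n) q j"
    using q by (simp add: qpoch_Suc_shift)
  have "(1 - E * q ^ n) * qpoch (E * q ^ Suc n) q (Suc j) = qpoch (E * q ^ n) q (Suc (Suc j))"
    by (simp add: qpoch_Suc_shift[of "E * q ^ n"] mult_ac)
  also have "\<dots> = qpoch (E * q ^ n) q j * (1 - E * q ^ n * q ^ j) * (1 - E * q ^ n * q ^ j * q)"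
    by (simp add: qpoch_Suc mult_ac)
  finally have 2: "(1 - E * q ^ n) * qpoch (E * q ^ Suc n) q (Suc j) = \<dots>" .
  have "(1 - E * q ^ n) * racah_term q A B D E (Suc n) (Suc j)
    = qpoch (1 / q ^ Suc n) q (Suc j) * ((1 - E * q ^ n) * qpoch (E * q ^ Suc n) q (Suc j))
     / (qpoch A q (Suc j) * qpoch B q (Suc j) * qpoch D q (Suc j) * qpoch q q (Suc j)) * q ^ Suc j"
    by (simp add: racah_term_def)
  also have "\<dots> = F * q * (1 - 1 / (q * q ^ n)) * (1 - E * q ^ n * q ^ j) * (1 - E * q ^ n * q ^ j * q)"
    unfolding 1 2 F by simp
  finally show "(1 - E * q ^ n) * racah_term q A B D E (Suc n) (Suc j) = \<dots>" .
qed

text \<open>The same factor \<open>F\<close> serves index \<open>n - 1\<close>. Here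
  \<open>1 - 1 / q ^ n\<close> stays on the left; up to \<open>- q ^ n\<close> it is the factor
  \<open>1 - q ^ n\<close> of \<open>racah_down\<close>.\<close>

lemma racah_term_pred:
  assumes q: "0 < q" "q < 1" and n: "n = Suc m"
    and F: "F = qpoch (1 / q ^ n) q j * qpoch (E * q ^ n) q j * q ^ j
      / (qpoch A q (Suc j) * qpoch B q (Suc j) * qpoch D q (Suc j) * qpoch q q (Suc j))"
  shows "(1 - 1 / q ^ n) * racah_term q A B D E m (Suc j)
      = F * q * (1 - q ^ j / q ^ n) * (1 - q * q ^ j / q ^ n) * (1 - E * q ^ n / q)"
proof -
  have "(1 - 1 / q ^ n) * qpoch (1 / q ^ m) q (Suc j) = qpoch (1 / q ^ n) q (Suc (Suc j))"
    using q by (simp add: n qpoch_Suc_shift[of "1 / (q * q ^ m)"])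
  also have "\<dots> = qpoch (1 / q ^ n) q j * (1 - q ^ j / q ^ n) * (1 - q * q ^ j / q ^ n)"
    by (simp add: qpoch_Suc)
  finally have 1: "(1 - 1 / q ^ n) * qpoch (1 / q ^ m) q (Suc j) = \<dots>" .
  have 2: "qpoch (E * q ^ m) q (Suc j) = (1 - E * q ^ n / q) * qpoch (E * q ^ n) q j"
    using q by (simp add: n qpoch_Suc_shift mult_ac)
  have "(1 - 1 / q ^ n) * racah_term q A B D E m (Suc j)
    = ((1 - 1 / q ^ n) * qpoch (1 / q ^ m) q (Suc j)) * qpoch (E * q ^ m) q (Suc j)
     / (qpoch A q (Suc j) * qpoch B q (Suc j) * qpoch D q (Suc j) * qpoch q q (Suc j)) * q ^ Suc j"
    by (simp add: racah_term_def)
  also have "\<dots> = F * q * (1 - q ^ j / q ^ n) * (1 - q * q ^ j / q ^ n) * (1 - E * q ^ n / q)"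
    unfolding 1 2 F by simp
  finally show ?thesis .
qed

text \<open>This compares the coefficients of \<open>phi (Suc j)\<close> in the recurrence. Both
  sides are multiples of \<open>F * (1 - q * J)\<close>, and the cofactors agree by
  \<open>racah_core_identity\<close>.\<close>

lemma racah_term_recurrence:
  assumes q: "0 < q" "q < 1" and w: "w * q\<^sup>2 * E = A * B * D"
    and ABDE: "A \<noteq> 0" "B \<noteq> 0" "D \<noteq> 0" "E \<noteq> 0"
    and nz: "qpoch A q (Suc j) \<noteq> 0" "qpoch B q (Suc j) \<noteq> 0" "qpoch D q (Suc j) \<noteq> 0"
    and E: "E < q"
  shows "(1 - q ^ Suc j) * (1 - w * q ^ (j + 2)) / q ^ Suc j * racah_term q A B D E n (Suc j)
       - racah_term q A B D E n j / q ^ j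
     = racah_up q A B D E n
         * (racah_term q A B D E (Suc n) (Suc j) - racah_term q A B D E n (Suc j))
       - racah_down q A B D E n
         * (racah_term q A B D E n (Suc j) - racah_term q A B D E (n - 1) (Suc j))"
proof -
  define Q J V where "Q = q ^ n" and "J = q ^ j" and "V = w * q\<^sup>2"
  define F where "F = qpoch (1 / q ^ n) q j * qpoch (E * q ^ n) q j * q ^ j
      / (qpoch A q (Suc j) * qpoch B q (Suc j) * qpoch D q (Suc j) * qpoch q q (Suc j))"
  have pos: "Q > 0" "J > 0" "Q \<noteq> 0" "J \<noteq> 0" and q0: "q \<noteq> 0"
    using q by (auto simp: Q_def J_def)
  \<comment> \<open>The bound by \<open>q\<close> is for the denominator
    \<open>1 - E * Q\<^sup>2 / q\<close> of \<open>racah_down\<close>, which at \<open>n = 0\<close>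
    is \<open>1 - E / q\<close>.\<close>
  have "E * Q\<^sup>2 < q" "E * Q\<^sup>2 < 1" "E * Q\<^sup>2 * q < 1"
    using mult_power_less[OF q E q(1), of "2 * n"] mult_power_less[OF q _ zero_less_one, of E "2 * n"]
      mult_power_less[OF q _ zero_less_one, of E "2 * n + 1"] E q
    by (simp_all add: Q_def power_mult power2_eq_square mult_ac)
  then have den: "1 - E * Q\<^sup>2 \<noteq> 0" "1 - E * Q\<^sup>2 / q \<noteq> 0" "1 - E * Q\<^sup>2 * q \<noteq> 0"
    using q by (auto simp: field_simps)
  note T = racah_term_Suc[OF q nz F_def, folded Q_def J_def]
  \<comment> \<open>The difference of terms produces \<open>1 - q * J\<close> and a factor that
    cancels \<open>1 - E * Q\<^sup>2 * q\<close> in \<open>racah_up\<close>; \<open>Yd\<close> is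
    the analogue for \<open>racah_down\<close>.\<close>
  have Xd: "racah_up q A B D E n
      * (racah_term q A B D E (Suc n) (Suc j) - racah_term q A B D E n (Suc j))
    = - (F * (1 - q * J) * ((1 - A * Q) * (1 - B * Q) * (1 - D * Q) * (1 - E * Q * J)
         / (Q * (1 - E * Q\<^sup>2))))"
  proof -
    have "(1 - E * Q) * (racah_term q A B D E (Suc n) (Suc j) - racah_term q A B D E n (Suc j))
      = F * q * (1 - 1 / (q * Q)) * (1 - E * Q * J) * (1 - E * Q * J * q)
        - (1 - E * Q) * (F * q * (1 - J / Q) * (1 - E * Q * J))"
      unfolding right_diff_distrib T by simp
    also have "\<dots> = F * (1 - E * Q * J) * - ((1 - q * J) / Q * (1 - E * Q\<^sup>2 * q))"
      using pos q0 by (simp add: field_simps power2_eq_square)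
    finally have d: "(1 - E * Q) * (racah_term q A B D E (Suc n) (Suc j) - racah_term q A B D E n (Suc j))
      = \<dots>" .
    have "racah_up q A B D E n
      * (racah_term q A B D E (Suc n) (Suc j) - racah_term q A B D E n (Suc j))
      = (1 - A * Q) * (1 - B * Q) * (1 - D * Q) / ((1 - E * Q\<^sup>2) * (1 - E * Q\<^sup>2 * q))
       * ((1 - E * Q) * (racah_term q A B D E (Suc n) (Suc j) - racah_term q A B D E n (Suc j)))"
      by (simp add: racah_up_def Q_def power_mult[symmetric] mult_ac power_Suc2)
    also have "\<dots> = (1 - A * Q) * (1 - B * Q) * (1 - D * Q) / (1 - E * Q\<^sup>2)
       * (F * (1 - E * Q * J) * - ((1 - q * J) / Q))"
      unfolding d using den by simp
    finally show ?thesis by (simp add: mult_ac)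
  qed
  have Yd: "racah_down q A B D E n
      * (racah_term q A B D E n (Suc j) - racah_term q A B D E (n - 1) (Suc j))
    = F * (1 - q * J) * (V * (1 - J / Q) * (1 - E * Q / A) * (1 - E * Q / B) * (1 - E * Q / D)
       / (1 - E * Q\<^sup>2))"
  proof (cases n)
    \<comment> \<open>Here \<open>n - 1\<close> is again \<open>0\<close>. The left side vanishes
      through \<open>1 - q ^ 0\<close>, the right side because \<open>J = Q\<close> if
      \<open>j = 0\<close> and \<open>qpoch 1 q j = 0\<close> otherwise.\<close>
    case 0
    have "F * (1 - J / Q) = 0"
      using q by (cases j) (auto simp: F_def 0 Q_def J_def qpoch_Suc_shift)
    moreover have "racah_down q A B D E n = 0" by (simp add: racah_down_def 0)
    ultimately show ?thesis by auto
  next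
    case (Suc m)
    have "(1 - 1 / Q) * (racah_term q A B D E n (Suc j) - racah_term q A B D E m (Suc j))
      = (1 - 1 / Q) * (F * q * (1 - J / Q) * (1 - E * Q * J))
        - F * q * (1 - J / Q) * (1 - q * J / Q) * (1 - E * Q / q)"
      unfolding right_diff_distrib T racah_term_pred[OF q Suc F_def, folded Q_def J_def] by simp
    also have "\<dots> = F * q * (1 - J / Q) * - ((1 - q * J) / Q * (1 - E * Q\<^sup>2 / q))"
      using pos q0 by (simp add: field_simps power2_eq_square)
    finally have d: "(1 - 1 / Q) * (racah_term q A B D E n (Suc j) - racah_term q A B D E m (Suc j))
      = \<dots>" .
    have V: "A * B * D / (E * q) = V / q"
      using w ABDE q0 by (simp add: V_def field_simps)
    have Q1: "1 - Q = - Q * (1 - 1 / Q)" using pos by (simp add: field_simps)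
    have "racah_down q A B D E n
      * (racah_term q A B D E n (Suc j) - racah_term q A B D E m (Suc j))
      = V / q * (1 - E * Q / A) * (1 - E * Q / B) * (1 - E * Q / D)
         / ((1 - E * Q\<^sup>2 / q) * (1 - E * Q\<^sup>2)) * (- Q)
       * ((1 - 1 / Q) * (racah_term q A B D E n (Suc j) - racah_term q A B D E m (Suc j)))"
      unfolding racah_down_def V Q_def[symmetric] Q1
      by (simp add: Q_def power_mult[symmetric] mult_ac)
    also have "\<dots> = V * (1 - E * Q / A) * (1 - E * Q / B) * (1 - E * Q / D)
         / (1 - E * Q\<^sup>2) * (F * (1 - J / Q) * (1 - q * J))"
      unfolding d using den(2) pos q0 by simp
    finally show ?thesis by (simp add: Suc mult_ac)
  qed
  have "(1 - q ^ Suc j) * (1 - w * q ^ (j + 2)) / q ^ Suc j * racah_term q A B D E n (Suc j)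
       - racah_term q A B D E n j / q ^ j
    = F * (1 - q * J) * (((1 - V * J) * (1 - J / Q) * (1 - E * Q * J)
        - (1 - A * J) * (1 - B * J) * (1 - D * J)) / J)"
  proof -
    have "q ^ (j + 2) = q\<^sup>2 * J" by (simp add: J_def power_add power2_eq_square mult_ac)
    then show ?thesis
      unfolding T using q0 pos by (simp add: J_def[symmetric] V_def field_simps power2_eq_square)
  qed
  also have "\<dots> = F * (1 - q * J) * (- ((1 - A * Q) * (1 - B * Q) * (1 - D * Q) * (1 - E * Q * J) / (Q * (1 - E * Q\<^sup>2)))
      - V * (1 - J / Q) * (1 - E * Q / A) * (1 - E * Q / B) * (1 - E * Q / D) / (1 - E * Q\<^sup>2))"
    using racah_core_identity[of V E A B D J Q] w ABDE pos den by (simp add: V_def)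
  also have "\<dots> = racah_up q A B D E n
         * (racah_term q A B D E (Suc n) (Suc j) - racah_term q A B D E n (Suc j))
       - racah_down q A B D E n
         * (racah_term q A B D E n (Suc j) - racah_term q A B D E (n - 1) (Suc j))"
    unfolding Xd Yd by (simp add: right_diff_distrib)
  finally show ?thesis .
qed

text \<open>
  Multiplication by \<open>x\<close> only shifts the basis \<open>phi\<close> by one, so that the recurrence can be
  compared coefficient by coefficient.
\<close>

lemma racah_sum_recurrence:
  fixes phi :: "nat \<Rightarrow> real"
  assumes q: "0 < q" "q < 1" and w: "w * q\<^sup>2 * E = A * B * D"
    and ABDE: "A \<noteq> 0" "B \<noteq> 0" "D \<noteq> 0" "E \<noteq> 0"
    and nz: "\<And>k. k \<le> Suc n \<Longrightarrow> qpoch A q k \<noteq> 0" "\<And>k. k \<le> Suc n \<Longrightarrow> qpoch B q k \<noteq> 0"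
      "\<And>k. k \<le> Suc n \<Longrightarrow> qpoch D q k \<noteq> 0"
    and E: "E < q"
    and phi: "\<And>k. phi (Suc k) = phi k * (1 + w * q ^ (2 * k + 1) - x * q ^ k)"
    and p: "\<And>m. p m = (\<Sum>k\<le>m. racah_term q A B D E m k * phi k)"
  shows "x * p n = (1 + w * q) * p n + racah_up q A B D E n * (p (Suc n) - p n)
     - racah_down q A B D E n * (p n - p (n - 1))"
proof -
  let ?e = "racah_term q A B D E"
  let ?X = "racah_up q A B D E n" and ?Y = "racah_down q A B D E n"
  have q0: "q \<noteq> 0" using q by simp
  have e0: "?e m k = 0" if "m < k" for m k
    using that q0 by (simp add: racah_term_def qpoch_inverse_power_eq_0)
  have e1: "?e m 0 = 1" for m by (simp add: racah_term_def)
  \<comment> \<open>Padding with zero terms gives \<open>p (n - 1)\<close>, \<open>p n\<close> and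
    \<open>p (Suc n)\<close> one common range, and their equal \<open>phi 0\<close> parts cancel in
    differences.\<close>
  have ext: "p m = phi 0 + (\<Sum>j\<le>n. ?e m (Suc j) * phi (Suc j))" if "m \<le> Suc n" for m
  proof -
    have "p m = (\<Sum>k\<le>Suc n. ?e m k * phi k)"
      unfolding p using that by (intro sum.mono_neutral_left) (auto simp: e0)
    then show ?thesis by (subst (asm) sum.atMost_Suc_shift) (simp add: e1)
  qed
  have xphi: "(x - (1 + w * q)) * phi k
      = (1 - q ^ k) * (1 - w * q ^ (k + 1)) / q ^ k * phi k - phi (Suc k) / q ^ k" for k
    unfolding phi using q0
    by (simp add: field_simps power_mult power2_eq_square power_add)
  have "(x - (1 + w * q)) * p n = (\<Sum>k\<le>n. ?e n k * ((x - (1 + w * q)) * phi k))"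
    unfolding p sum_distrib_left by (simp add: mult_ac)
  also have "\<dots> = (\<Sum>k\<le>n. (1 - q ^ k) * (1 - w * q ^ (k + 1)) / q ^ k * ?e n k * phi k)
      - (\<Sum>k\<le>n. ?e n k / q ^ k * phi (Suc k))"
    unfolding xphi sum_subtractf[symmetric] by (simp add: algebra_simps)
  \<comment> \<open>The added term \<open>k = Suc n\<close> is zero by \<open>e0\<close>, and
    \<open>k = 0\<close> then drops out through \<open>1 - q ^ 0\<close>, so both sums run over
    \<open>phi (Suc j)\<close>.\<close>
  also have "(\<Sum>k\<le>n. (1 - q ^ k) * (1 - w * q ^ (k + 1)) / q ^ k * ?e n k * phi k)
      = (\<Sum>k\<le>Suc n. (1 - q ^ k) * (1 - w * q ^ (k + 1)) / q ^ k * ?e n k * phi k)"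
    by (intro sum.mono_neutral_left) (auto simp: e0)
  also have "\<dots> = (\<Sum>j\<le>n. (1 - q ^ Suc j) * (1 - w * q ^ (j + 2)) / q ^ Suc j
      * ?e n (Suc j) * phi (Suc j))"
    by (subst sum.atMost_Suc_shift) simp
  also have "\<dots> - (\<Sum>k\<le>n. ?e n k / q ^ k * phi (Suc k))
    = (\<Sum>j\<le>n. ((1 - q ^ Suc j) * (1 - w * q ^ (j + 2)) / q ^ Suc j * ?e n (Suc j)
        - ?e n j / q ^ j) * phi (Suc j))"
    unfolding sum_subtractf[symmetric] by (simp add: left_diff_distrib)
  also have "\<dots> = (\<Sum>j\<le>n. (?X * (?e (Suc n) (Suc j) - ?e n (Suc j))
      - ?Y * (?e n (Suc j) - ?e (n - 1) (Suc j))) * phi (Suc j))"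
    by (intro sum.cong refl, subst racah_term_recurrence[OF q w ABDE _ _ _ E])
      (auto simp del: power_Suc intro!: nz)
  also have "\<dots> = ?X * (p (Suc n) - p n) - ?Y * (p n - p (n - 1))"
    by (simp add: ext sum_distrib_left sum_subtractf algebra_simps sum.distrib)
  finally show ?thesis by (simp add: algebra_simps)
qed

section \<open>Monic normalisation\<close>

definition racah_lead :: "real \<Rightarrow> real \<Rightarrow> real \<Rightarrow> real \<Rightarrow> real \<Rightarrow> nat \<Rightarrow> real" where
  "racah_lead q A B D E n =
     qpoch A q n * qpoch B q n * qpoch D q n / qpoch (E * q ^ n) q n"

text \<open>\<open>racah_lead\<close> is the reciprocal of the leading coefficient in
  \<open>x\<close>, so its ratio of successive values is the coefficient of \<open>p (Suc n)\<close>
  in the recurrence. The shifted factorials in \<open>E\<close> are matched by computing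
  \<open>qpoch (E * q ^ n) q (Suc (Suc n))\<close> from both ends.\<close>

lemma racah_lead_Suc:
  assumes q: "0 < q" "q < 1" and E: "E < 1"
  shows "racah_lead q A B D E (Suc n) = racah_lead q A B D E n * racah_up q A B D E n"
proof -
  have E1: "E * q ^ m \<noteq> 1" "1 - E * q ^ m \<noteq> 0" for m
    using mult_power_less[OF q E zero_less_one, of m] by auto
  have nz: "qpoch (E * q ^ m) q k \<noteq> 0" for m k
    using mult_power_less[OF q E zero_less_one, of m] q by (intro qpoch_nonzero_lt_1) auto
  have "(1 - E * q ^ n) * qpoch (E * q ^ Suc n) q (Suc n) = qpoch (E * q ^ n) q (Suc (Suc n))"
    by (simp add: qpoch_Suc_shift[of "E * q ^ n"] mult_ac)
  also have "\<dots> = qpoch (E * q ^ n) q n * ((1 - E * q ^ (2 * n)) * (1 - E * q ^ (2 * n + 1)))"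
    by (simp add: qpoch_Suc mult_ac power_mult power2_eq_square)
  finally have *: "(1 - E * q ^ n) * qpoch (E * q ^ Suc n) q (Suc n) = \<dots>" .
  have "racah_lead q A B D E (Suc n) = (1 - E * q ^ n) * (qpoch A q (Suc n) * qpoch B q (Suc n)
      * qpoch D q (Suc n)) / ((1 - E * q ^ n) * qpoch (E * q ^ Suc n) q (Suc n))"
    using E1 by (simp add: racah_lead_def)
  also have "\<dots> = racah_lead q A B D E n * racah_up q A B D E n"
    unfolding * racah_lead_def racah_up_def by (simp add: qpoch_Suc mult_ac)
  finally show ?thesis .
qed

text \<open>Multiplying \<open>racah_sum_recurrence\<close> by \<open>racah_lead\<close> absorbs
  \<open>racah_up\<close> at \<open>n\<close> into \<open>P (Suc n)\<close> and releases
  \<open>racah_up\<close> at \<open>n - 1\<close> in front of the previous polynomial.\<close>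

lemma monic_racah_recurrence:
  fixes phi :: "nat \<Rightarrow> real"
  assumes q: "0 < q" "q < 1" and w: "w * q\<^sup>2 * E = A * B * D"
    and ABDE: "A \<noteq> 0" "B \<noteq> 0" "D \<noteq> 0" "E \<noteq> 0"
    and nz: "\<And>k. k \<le> Suc n \<Longrightarrow> qpoch A q k \<noteq> 0" "\<And>k. k \<le> Suc n \<Longrightarrow> qpoch B q k \<noteq> 0"
      "\<And>k. k \<le> Suc n \<Longrightarrow> qpoch D q k \<noteq> 0"
    and E: "E < q"
    and phi: "\<And>k. phi (Suc k) = phi k * (1 + w * q ^ (2 * k + 1) - x * q ^ k)"
    and P: "\<And>m. P m = racah_lead q A B D E m * (\<Sum>k\<le>m. racah_term q A B D E m k * phi k)"
  shows "x * P n = P (Suc n) + (1 + w * q - racah_up q A B D E n - racah_down q A B D E n) * P n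
     + racah_up q A B D E (n - 1) * racah_down q A B D E n * prev P n"
proof -
  define p where "p m = (\<Sum>k\<le>m. racah_term q A B D E m k * phi k)" for m
  have P': "P m = racah_lead q A B D E m * p m" for m by (simp add: P p_def)
  have E1: "E < 1" using E q by simp
  note Suc = racah_lead_Suc[OF q E1, of A B D]
  have rec: "x * p n = (1 + w * q) * p n + racah_up q A B D E n * (p (Suc n) - p n)
     - racah_down q A B D E n * (p n - p (n - 1))"
    by (rule racah_sum_recurrence[OF q w ABDE nz E phi p_def])
  \<comment> \<open>At \<open>n = 0\<close> both sides are zero: \<open>prev\<close> on the left,
    \<open>racah_down\<close> on the right.\<close>
  have pr: "racah_up q A B D E (n - 1) * racah_down q A B D E n * prev P n
    = racah_down q A B D E n * racah_lead q A B D E n * p (n - 1)"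
    by (cases n) (simp_all add: prev_def racah_down_def P' Suc)
  have "x * P n = racah_lead q A B D E n * (x * p n)" by (simp add: P')
  then show ?thesis
    unfolding rec pr unfolding P' Suc by (simp add: algebra_simps)
qed

section \<open>Rescaling the non-standard q-Racah polynomials\<close>

lemma qbr_eq:
  assumes "0 < q"
  shows "qbr q s = - (q powr (- s / 2) * (1 - q powr s) / kappa q)"
proof -
  have "q powr (- s / 2) * q powr s = q powr (s / 2)"
    by (simp flip: powr_add)
  then have "- (q powr (- s / 2) * (1 - q powr s)) = q powr (s / 2) - q powr (- s / 2)"
    by (simp add: algebra_simps)
  then show ?thesis unfolding qbr_def kappa_def minus_divide_left by simp
qed

lemma kappa_nonzero:
  assumes "0 < q" "q < 1"
  shows "kappa q \<noteq> 0"
  using powr_less_mono'[of q "-1/2" "1/2"] assms by (simp add: kappa_def)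

text \<open>The shape of both fractions in \<open>qRacah_beta\<close>: four brackets over two leave
  two powers of \<open>kappa q\<close>, and the half powers of \<open>q\<close> merge into
  one.\<close>

lemma qbr_quotient:
  assumes "0 < q" "q < 1"
  shows "qbr q c * qbr q d * qbr q e * qbr q f / (qbr q g * qbr q h)
    = q powr ((g + h - c - d - e - f) / 2) / (kappa q)\<^sup>2
      * ((1 - q powr c) * (1 - q powr d) * (1 - q powr e) * (1 - q powr f)
         / ((1 - q powr g) * (1 - q powr h)))"
proof -
  have *: "q powr ((g + h - c - d - e - f) / 2) = q powr (- c / 2) * q powr (- d / 2)
      * q powr (- e / 2) * q powr (- f / 2) / (q powr (- g / 2) * q powr (- h / 2))"
  proof -
    have x: "(g + h - c - d - e - f) / 2
        = (- c / 2) + (- d / 2) + (- e / 2) + (- f / 2) - ((- g / 2) + (- h / 2))"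
      by (simp add: field_simps)
    show ?thesis unfolding x powr_add powr_diff ..
  qed
  show ?thesis
    unfolding * qbr_eq[OF assms(1)] using assms kappa_nonzero[OF assms]
    by (simp add: power2_eq_square mult_ac)
qed

lemma basic_hypergeom_terminating:
  assumes "q \<noteq> 0"
  shows "basic_hypergeom ((1 / q ^ n) # as) bs q z =
     (\<Sum>k\<le>n. qpochs ((1 / q ^ n) # as) q k / (qpochs bs q k * qpoch q q k) * z ^ k)"
  unfolding basic_hypergeom_def
  by (intro suminf_finite) (auto simp: qpochs_def qpoch_inverse_power_eq_0[OF assms])

lemma powr_minus_real_nat: "0 < q \<Longrightarrow> q powr (- real n) = 1 / q ^ n"
  by (simp add: powr_minus powr_realpow inverse_eq_divide)

section \<open>Translation of the parameters\<close>

context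
  fixes q \<gamma> \<delta> a b \<beta> :: real and N :: nat
  assumes q: "0 < q" "q < 1"
    and b: "b = a + real N + 1" and \<beta>: "q powr \<beta> = \<gamma>" and a: "q powr (2 * a) = \<gamma> * \<delta>"
begin

text \<open>Only \<open>D\<close> and \<open>E\<close> carry \<open>q powr \<alpha>\<close>: both
  tend to zero, while \<open>A\<close>, \<open>B\<close> and the quotient of \<open>E\<close> by
  \<open>D\<close> do not depend on \<alpha>.\<close>

private abbreviation (input) "A \<equiv> 1 / q ^ N"
private abbreviation (input) "B \<equiv> \<gamma> * q"
private abbreviation (input) "D \<equiv> \<lambda>\<alpha>. \<gamma> * \<delta> * q ^ (N + 2) * q powr \<alpha>"
private abbreviation (input) "E \<equiv> \<lambda>\<alpha>. \<gamma> * q * q powr \<alpha>"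
private abbreviation (input) "lattice_basis \<equiv> \<lambda>s k. qpoch (1 / q ^ s) q k * qpoch (\<gamma> * \<delta> * q ^ (s + 1)) q k"
private abbreviation (input) "rescale \<equiv> q powr (a + 1) / c1 q"

lemma parameters_pos: "\<gamma> > 0" "\<delta> > 0"
proof -
  show g: "\<gamma> > 0" using q \<beta> by auto
  have "\<gamma> * \<delta> > 0" using q by (simp flip: a)
  then show "\<delta> > 0" using g by (simp add: zero_less_mult_iff)
qed

lemma powr_parameters:
  "q powr (a - b + 1) = A" "q powr (\<beta> + 1) = B"
  "q powr (a + b + \<alpha> + 1) = D \<alpha>" "q powr (\<alpha> + \<beta> + real n + 1) = E \<alpha> * q ^ n"
proof -
  show "q powr (a - b + 1) = A" using powr_minus_real_nat[of q N] q by (simp add: b)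
  show "q powr (\<beta> + 1) = B" using q by (simp add: powr_add \<beta>)
  have "a + b + \<alpha> + 1 = 2 * a + real (N + 2) + \<alpha>" by (simp add: b)
  then show "q powr (a + b + \<alpha> + 1) = D \<alpha>"
    using q by (simp only: powr_add a powr_realpow)
  show "q powr (\<alpha> + \<beta> + real n + 1) = E \<alpha> * q ^ n"
    using q by (simp add: powr_add \<beta> powr_realpow)
qed

lemma rescale_eq: "rescale = q powr (a + 1 / 2) * (kappa q)\<^sup>2"
proof -
  have "q powr (a + 1) = q powr (a + 1 / 2) * q powr (1 / 2)"
    by (simp add: add.commute flip: powr_add)
  then show ?thesis using q kappa_nonzero[OF q] by (simp add: c1_def)
qed

text \<open>Since \<open>\<gamma> * \<delta> * q = q powr (2 * a + 1)\<close>, the sequence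
  \<open>norm_C\<close> is geometric. Its ratio \<open>rescale\<close> is also the slope that turns
  \<open>mu\<close> into \<open>dqHahn_x\<close>, which keeps the rescaled polynomials
  monic.\<close>

lemma norm_C_Suc: "norm_C q \<gamma> \<delta> (Suc n) = rescale * norm_C q \<gamma> \<delta> n"
proof -
  have "\<gamma> * \<delta> * q = q powr (2 * a + 1)" using q by (simp add: powr_add a)
  then have "norm_C q \<gamma> \<delta> m = q powr ((2 * a + 1) * (real m / 2)) * kappa q ^ (2 * m)" for m
    by (simp add: norm_C_def powr_powr)
  moreover have "(2 * a + 1) * (real (Suc n) / 2) = (a + 1 / 2) + (2 * a + 1) * (real n / 2)"
    by (simp add: field_simps)
  ultimately show ?thesis
    unfolding rescale_eq by (simp only: powr_add) (simp add: power2_eq_square mult_ac)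
qed

lemma norm_C_nonzero: "norm_C q \<gamma> \<delta> n \<noteq> 0"
  using parameters_pos q kappa_nonzero[OF q] by (simp add: norm_C_def)

text \<open>\<open>norm_C\<close> cancels the powers of \<open>q\<close> and \<open>kappa q\<close>
  in front of the series, and the shift by \<open>a\<close> turns the two lattice parameters into
  \<open>q powr (- s)\<close> and \<open>\<gamma> * \<delta> * q powr (s + 1)\<close>.\<close>

lemma scaled_qRacah:
  "norm_C q \<gamma> \<delta> n * qRacah q a b \<alpha> \<beta> n (real s + a)
   = racah_lead q A B (D \<alpha>) (E \<alpha>) n
     * (\<Sum>k\<le>n. racah_term q A B (D \<alpha>) (E \<alpha>) n k * lattice_basis s k)"
proof -
  have g: "\<gamma> * \<delta> * q = q powr (2 * a + 1)" using q by (simp add: powr_add a)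
  have "norm_C q \<gamma> \<delta> n * q powr (- (real n / 2) * (2 * a + 1)) = kappa q ^ (2 * n)"
    unfolding norm_C_def g powr_powr using q by (simp add: mult_ac flip: powr_add)
  then have c: "norm_C q \<gamma> \<delta> n * (q powr (- (real n / 2) * (2 * a + 1)) * X / (kappa q ^ (2 * n) * Y) * Z)
     = X / Y * Z" for X Y Z
    using kappa_nonzero[OF q] by (simp add: divide_simps)
  have e: "q powr (a - (real s + a)) = 1 / q ^ s"
    "q powr (a + (real s + a) + 1) = \<gamma> * \<delta> * q ^ (s + 1)"
  proof -
    show "q powr (a - (real s + a)) = 1 / q ^ s" using powr_minus_real_nat[of q s] q by simp
    have "a + (real s + a) + 1 = 2 * a + real (s + 1)" by simp
    then show "q powr (a + (real s + a) + 1) = \<gamma> * \<delta> * q ^ (s + 1)"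
      using q by (simp only: powr_add a powr_realpow)
  qed
  have q0: "q \<noteq> 0" using q by simp
  show ?thesis
    unfolding qRacah_def c unfolding e powr_parameters powr_minus_real_nat[OF q(1)]
      basic_hypergeom_terminating[OF q0]
    by (simp add: qpochs_def racah_lead_def racah_term_def mult_ac)
qed


section \<open>The rescaled recurrence coefficients\<close>

lemma scaled_qRacah_beta_up:
  "rescale * (qbr q (\<alpha> + \<beta> + real n + 1) * qbr q (a - b + real n + 1)
         * qbr q (\<beta> + real n + 1) * qbr q (a + b + \<alpha> + real n + 1)
       / (qbr q (\<alpha> + \<beta> + 2 * real n + 1) * qbr q (\<alpha> + \<beta> + 2 * real n + 2)))
   = racah_up q A B (D \<alpha>) (E \<alpha>) n"
proof -
  have pn: "q powr (x + real k) = q powr x * q ^ k" for x k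
    using q by (simp add: powr_add powr_realpow)
  have e: "q powr (\<alpha> + \<beta> + real n + 1) = E \<alpha> * q ^ n"
      "q powr (a - b + real n + 1) = A * q ^ n"
      "q powr (\<beta> + real n + 1) = B * q ^ n"
      "q powr (a + b + \<alpha> + real n + 1) = D \<alpha> * q ^ n"
      "q powr (\<alpha> + \<beta> + 2 * real n + 1) = E \<alpha> * q ^ (2 * n)"
      "q powr (\<alpha> + \<beta> + 2 * real n + 2) = E \<alpha> * q ^ (2 * n + 1)"
  proof -
    show "q powr (\<alpha> + \<beta> + real n + 1) = E \<alpha> * q ^ n" by (rule powr_parameters)
    show "q powr (a - b + real n + 1) = A * q ^ n"
      using pn[of "a - b + 1" n] unfolding powr_parameters by (simp add: algebra_simps)
    show "q powr (\<beta> + real n + 1) = B * q ^ n"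
      using pn[of "\<beta> + 1" n] unfolding powr_parameters by (simp add: add_ac)
    show "q powr (a + b + \<alpha> + real n + 1) = D \<alpha> * q ^ n"
      using pn[of "a + b + \<alpha> + 1" n] unfolding powr_parameters by (simp add: add_ac)
    show "q powr (\<alpha> + \<beta> + 2 * real n + 1) = E \<alpha> * q ^ (2 * n)"
      using powr_parameters(4)[of \<alpha> "2 * n"] by simp
    have "\<alpha> + \<beta> + 2 * real n + 2 = \<alpha> + \<beta> + real (2 * n + 1) + 1" by simp
    then show "q powr (\<alpha> + \<beta> + 2 * real n + 2) = E \<alpha> * q ^ (2 * n + 1)"
      by (simp only: powr_parameters)
  qed
  \<comment> \<open>The exponent collected from the brackets is independent of \<open>n\<close>,
    \<alpha> and \<beta>, and \<open>rescale\<close> cancels it exactly.\<close>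
  have "(\<alpha> + \<beta> + 2 * real n + 1 + (\<alpha> + \<beta> + 2 * real n + 2) - (\<alpha> + \<beta> + real n + 1)
      - (a - b + real n + 1) - (\<beta> + real n + 1) - (a + b + \<alpha> + real n + 1)) / 2 = - (a + 1 / 2)"
    by (simp add: field_simps)
  moreover have "rescale * (q powr (- (a + 1 / 2)) / (kappa q)\<^sup>2 * X) = X" for X
    unfolding rescale_eq powr_minus using q kappa_nonzero[OF q] by simp
  ultimately show ?thesis
    unfolding qbr_quotient[OF q] e racah_up_def by metis
qed

lemma scaled_qRacah_beta_down:
  "rescale * (qbr q (\<alpha> + real n) * qbr q (b - a + \<alpha> + \<beta> + real n)
         * qbr q (- a - b + \<beta> + real n) * qbr q (real n)
       / (qbr q (\<alpha> + \<beta> + 2 * real n) * qbr q (\<alpha> + \<beta> + 2 * real n + 1)))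
   = racah_down q A B (D \<alpha>) (E \<alpha>) n"
proof -
  have q0: "q \<noteq> 0" "\<gamma> \<noteq> 0" "\<delta> \<noteq> 0" "q powr \<alpha> \<noteq> 0" using q parameters_pos by auto
  have pn: "q powr (x + real k) = q powr x * q ^ k" for x k
    using q by (simp add: powr_add powr_realpow)
  have e: "q powr (\<alpha> + real n) = E \<alpha> * q ^ n / B"
      "q powr (b - a + \<alpha> + \<beta> + real n) = E \<alpha> * q ^ n / A"
      "q powr (- a - b + \<beta> + real n) = E \<alpha> * q ^ n / D \<alpha>"
      "q powr (real n) = q ^ n"
      "q powr (\<alpha> + \<beta> + 2 * real n) = E \<alpha> * q ^ (2 * n) / q"
      "q powr (\<alpha> + \<beta> + 2 * real n + 1) = E \<alpha> * q ^ (2 * n)"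
  proof -
    show "q powr (\<alpha> + real n) = E \<alpha> * q ^ n / B" using q0 by (simp add: pn)
    have "b - a + \<alpha> + \<beta> + real n = (\<alpha> + \<beta> + real n + 1) - (a - b + 1)" by simp
    then show "q powr (b - a + \<alpha> + \<beta> + real n) = E \<alpha> * q ^ n / A"
      by (simp only: powr_diff powr_parameters)
    have "- a - b + \<beta> + real n = (\<alpha> + \<beta> + real n + 1) - (a + b + \<alpha> + 1)" by simp
    then show "q powr (- a - b + \<beta> + real n) = E \<alpha> * q ^ n / D \<alpha>"
      by (simp only: powr_diff powr_parameters)
    show "q powr (real n) = q ^ n" using q by (simp add: powr_realpow)
    show 1: "q powr (\<alpha> + \<beta> + 2 * real n + 1) = E \<alpha> * q ^ (2 * n)"
      using powr_parameters(4)[of \<alpha> "2 * n"] by simp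
    have "\<alpha> + \<beta> + 2 * real n = (\<alpha> + \<beta> + 2 * real n + 1) - 1" by simp
    then show "q powr (\<alpha> + \<beta> + 2 * real n) = E \<alpha> * q ^ (2 * n) / q"
      using q 1 by (metis powr_diff powr_one less_imp_le)
  qed
  have x: "(\<alpha> + \<beta> + 2 * real n + (\<alpha> + \<beta> + 2 * real n + 1) - (\<alpha> + real n)
      - (b - a + \<alpha> + \<beta> + real n) - (- a - b + \<beta> + real n) - real n) / 2 = a + 1 / 2"
    by (simp add: field_simps)
  \<comment> \<open>The collected exponent now has the opposite sign, so it doubles the power in
    \<open>rescale\<close>; the result is the prefactor of \<open>racah_down\<close>.\<close>
  have w: "q powr (a + 1 / 2) * q powr (a + 1 / 2) = A * B * D \<alpha> / (E \<alpha> * q)"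
  proof -
    have "q powr (a + 1 / 2) * q powr (a + 1 / 2) = q powr (2 * a + 1)"
      by (simp flip: powr_add)
    also have "\<dots> = \<gamma> * \<delta> * q" using q by (simp add: powr_add a)
    finally show ?thesis using q0 by (simp add: power_add power2_eq_square)
  qed
  have r: "rescale * (q powr (a + 1 / 2) / (kappa q)\<^sup>2 * X)
      = q powr (a + 1 / 2) * q powr (a + 1 / 2) * X" for X
    unfolding rescale_eq using kappa_nonzero[OF q] by simp
  have perm: "K * (r * s * t * u / v) = K * u * s * r * t / v" for K r s t u v :: real
    by simp
  show ?thesis
    unfolding qbr_quotient[OF q] e x r w racah_down_def by (rule perm)
qed

text \<open>The bracket product in front of \<open>qRacah_beta\<close> is \<open>mu q a\<close>,
  which rescales to \<open>dqHahn_x\<close> at \<open>0\<close>, that is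
  \<open>1 + \<gamma> * \<delta> * q\<close>.\<close>

lemma scaled_qRacah_beta:
  "rescale * (qRacah_beta q a b \<alpha> \<beta> n - c3 q)
   = 1 + \<gamma> * \<delta> * q - racah_up q A B (D \<alpha>) (E \<alpha>) n - racah_down q A B (D \<alpha>) (E \<alpha>) n"
proof -
  have c1: "c1 q \<noteq> 0" using q kappa_nonzero[OF q] by (simp add: c1_def)
  have "q powr (a + 1) * (q powr a + q powr (- a - 1)) = q powr (2 * a + 1) + q powr 0"
    by (simp add: distrib_left flip: powr_add)
  also have "\<dots> = 1 + \<gamma> * \<delta> * q" using q by (simp add: powr_add a)
  finally have "rescale * (mu q a - c3 q) = 1 + \<gamma> * \<delta> * q"
    using c1 by (simp add: mu_eq[OF q(1)])
  then show ?thesis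
    unfolding scaled_qRacah_beta_up[symmetric] scaled_qRacah_beta_down[symmetric]
      qRacah_beta_def mu_def[symmetric] by (simp add: right_diff_distrib)
qed

text \<open>\<open>qRacah_gamma\<close> is the first fraction of \<open>qRacah_beta\<close> at
  \<open>n - 1\<close> times the second at \<open>n\<close>. Each needs one \<open>rescale\<close>,
  and the quotient of \<open>norm_C\<close> supplies the second.\<close>

lemma scaled_qRacah_gamma:
  assumes "1 \<le> n"
  shows "rescale * (norm_C q \<gamma> \<delta> n / norm_C q \<gamma> \<delta> (n - 1)) * qRacah_gamma q a b \<alpha> \<beta> n
   = racah_up q A B (D \<alpha>) (E \<alpha>) (n - 1) * racah_down q A B (D \<alpha>) (E \<alpha>) n"
proof -
  obtain m where n: "n = Suc m" using assms by (cases n) auto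
  have ratio: "norm_C q \<gamma> \<delta> n / norm_C q \<gamma> \<delta> (n - 1) = rescale"
    using norm_C_nonzero[of m] by (simp add: n norm_C_Suc)
  have m: "\<alpha> + \<beta> + real m + 1 = \<alpha> + \<beta> + real n" "a - b + real m + 1 = a - b + real n"
      "\<beta> + real m + 1 = \<beta> + real n" "a + b + \<alpha> + real m + 1 = a + b + \<alpha> + real n"
      "\<alpha> + \<beta> + 2 * real m + 1 = \<alpha> + \<beta> + 2 * real n - 1"
      "\<alpha> + \<beta> + 2 * real m + 2 = \<alpha> + \<beta> + 2 * real n"
    by (simp_all add: n)
  have "racah_up q A B (D \<alpha>) (E \<alpha>) (n - 1) * racah_down q A B (D \<alpha>) (E \<alpha>) n
    = rescale * rescale * qRacah_gamma q a b \<alpha> \<beta> n"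
    unfolding scaled_qRacah_beta_up[of \<alpha> m, unfolded m, symmetric] scaled_qRacah_beta_down[symmetric]
      n diff_Suc_1
    unfolding n[symmetric] scaled_qRacah_beta_up[of \<alpha> m, unfolded m, symmetric]
    by (simp add: qRacah_gamma_def power2_eq_square mult_ac)
  then show ?thesis by (simp only: ratio)
qed


section \<open>Nonvanishing denominators and the recurrence for large \<alpha>\<close>

lemma qpoch_A_nonzero: "k \<le> N \<Longrightarrow> qpoch A q k \<noteq> 0"
proof (rule qpoch_nonzero)
  fix i assume "k \<le> N" "i < k"
  then have "q ^ N < q ^ i" using q by (intro power_strict_decreasing) auto
  then have "q ^ i / q ^ N \<noteq> 1" using q by (subst right_inverse_eq) (auto simp only: power_eq_0_iff)
  then show "A * q ^ i \<noteq> 1" by simp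
qed

text \<open>In the first regime every factor is positive; in the second
  \<open>\<gamma> * q ^ Suc i\<close> exceeds \<open>q ^ Suc i / q ^ N\<close>, which is at least
  \<open>1\<close> for \<open>i < N\<close>, so every factor is negative.\<close>

lemma qpoch_B_nonzero:
  assumes "\<gamma> * q < 1 \<or> \<gamma> > q powr (- real N)" and "k \<le> N"
  shows "qpoch B q k \<noteq> 0"
  using assms(1)
proof
  assume "\<gamma> * q < 1"
  then show ?thesis using q by (intro qpoch_nonzero_lt_1) auto
next
  assume g: "\<gamma> > q powr (- real N)"
  show ?thesis
  proof (rule qpoch_nonzero)
    fix i assume "i < k"
    then have "q ^ N \<le> q ^ Suc i" using q assms(2) by (intro power_decreasing) auto
    then have "1 \<le> A * q ^ Suc i" using q by (simp add: field_simps)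
    also have "\<dots> < \<gamma> * q ^ Suc i"
      using g q by (intro mult_strict_right_mono) (auto simp: powr_minus_real_nat)
    finally show "B * q ^ i \<noteq> 1" by (simp add: mult_ac)
  qed
qed

text \<open>The bounds on \<open>E\<close> and \<open>D\<close> hold for large \<alpha> and exclude
  zero denominators; \<open>n < N\<close> keeps \<open>qpoch A q k\<close> nonzero up to index
  \<open>n + 1\<close>.\<close>

lemma scaled_qRacah_recurrence:
  assumes \<gamma>: "\<gamma> * q < 1 \<or> \<gamma> > q powr (- real N)" and \<alpha>: "E \<alpha> < q" "D \<alpha> < 1" and n: "n < N"
  shows "dqHahn_x q \<gamma> \<delta> (real s) * (norm_C q \<gamma> \<delta> n * qRacah q a b \<alpha> \<beta> n (real s + a))
     = norm_C q \<gamma> \<delta> (n + 1) * qRacah q a b \<alpha> \<beta> (n + 1) (real s + a)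
       + rescale * (qRacah_beta q a b \<alpha> \<beta> n - c3 q)
         * (norm_C q \<gamma> \<delta> n * qRacah q a b \<alpha> \<beta> n (real s + a))
       + rescale * (norm_C q \<gamma> \<delta> n / norm_C q \<gamma> \<delta> (n - 1)) * qRacah_gamma q a b \<alpha> \<beta> n
         * prev (\<lambda>m. norm_C q \<gamma> \<delta> m * qRacah q a b \<alpha> \<beta> m (real s + a)) n"
proof -
  note pos = parameters_pos
  have x: "dqHahn_x q \<gamma> \<delta> (real s) = 1 / q ^ s + \<gamma> * \<delta> * q ^ (s + 1)"
  proof -
    have "q powr (real s + 1) = q ^ (s + 1)"
      using q powr_realpow[of q "s + 1"] by (simp add: add.commute)
    then show ?thesis
      using q powr_minus_real_nat[of q s] by (simp add: dqHahn_x_def)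
  qed
  have phi: "lattice_basis s (Suc k) = lattice_basis s k
      * (1 + \<gamma> * \<delta> * q ^ (2 * k + 1) - dqHahn_x q \<gamma> \<delta> (real s) * q ^ k)" for k
  proof -
    have "(1 - 1 / q ^ s * q ^ k) * (1 - \<gamma> * \<delta> * q ^ (s + 1) * q ^ k)
        = 1 + \<gamma> * \<delta> * q ^ (2 * k + 1) - dqHahn_x q \<gamma> \<delta> (real s) * q ^ k"
      unfolding x using q by (simp add: field_simps power_mult power2_eq_square)
    then show ?thesis by (simp only: qpoch_Suc mult_ac)
  qed
  have w: "\<gamma> * \<delta> * q\<^sup>2 * E \<alpha> = A * B * D \<alpha>"
    using q by (simp add: power_add power2_eq_square)
  have "dqHahn_x q \<gamma> \<delta> (real s) * (norm_C q \<gamma> \<delta> n * qRacah q a b \<alpha> \<beta> n (real s + a))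
     = norm_C q \<gamma> \<delta> (Suc n) * qRacah q a b \<alpha> \<beta> (Suc n) (real s + a)
     + (1 + \<gamma> * \<delta> * q - racah_up q A B (D \<alpha>) (E \<alpha>) n - racah_down q A B (D \<alpha>) (E \<alpha>) n)
       * (norm_C q \<gamma> \<delta> n * qRacah q a b \<alpha> \<beta> n (real s + a))
     + racah_up q A B (D \<alpha>) (E \<alpha>) (n - 1) * racah_down q A B (D \<alpha>) (E \<alpha>) n
       * prev (\<lambda>m. norm_C q \<gamma> \<delta> m * qRacah q a b \<alpha> \<beta> m (real s + a)) n"
  proof (rule monic_racah_recurrence[OF q w _ _ _ _ _ _ _ \<alpha>(1) phi scaled_qRacah])
    fix k assume "k \<le> Suc n"
    then have k: "k \<le> N" using n by simp
    show "qpoch A q k \<noteq> 0" "qpoch B q k \<noteq> 0"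
      using qpoch_A_nonzero qpoch_B_nonzero[OF \<gamma>] k by auto
    show "qpoch (D \<alpha>) q k \<noteq> 0" using q \<alpha> by (intro qpoch_nonzero_lt_1)
  qed (use q pos in auto)
  moreover have "rescale * (norm_C q \<gamma> \<delta> n / norm_C q \<gamma> \<delta> (n - 1)) * qRacah_gamma q a b \<alpha> \<beta> n * prev f n
     = racah_up q A B (D \<alpha>) (E \<alpha>) (n - 1) * racah_down q A B (D \<alpha>) (E \<alpha>) n * prev f n" for f
  proof (cases n)
    case 0
    then show ?thesis by (simp add: prev_def)
  next
    case Suc
    then show ?thesis using scaled_qRacah_gamma[of n \<alpha>] by simp
  qed
  ultimately show ?thesis by (simp only: scaled_qRacah_beta Suc_eq_plus1)
qed

text \<open>The recurrence on the original lattice comes from the rescaled one on dividing by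
  \<open>rescale * norm_C q \<gamma> \<delta> n\<close>.\<close>

lemma qRacah_recurrence:
  assumes \<gamma>: "\<gamma> * q < 1 \<or> \<gamma> > q powr (- real N)" and \<alpha>: "E \<alpha> < q" "D \<alpha> < 1" and n: "n < N"
  shows "mu q (real s + a) * qRacah q a b \<alpha> \<beta> n (real s + a)
     = qRacah q a b \<alpha> \<beta> (n + 1) (real s + a)
       + qRacah_beta q a b \<alpha> \<beta> n * qRacah q a b \<alpha> \<beta> n (real s + a)
       + qRacah_gamma q a b \<alpha> \<beta> n * prev (\<lambda>m. qRacah q a b \<alpha> \<beta> m (real s + a)) n"
proof -
  let ?u = "\<lambda>m. qRacah q a b \<alpha> \<beta> m (real s + a)" and ?C = "norm_C q \<gamma> \<delta>"
  have c1: "c1 q \<noteq> 0" using q kappa_nonzero[OF q] by (simp add: c1_def)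
  have r0: "rescale \<noteq> 0" using c1 q by simp
  have x: "dqHahn_x q \<gamma> \<delta> (real s) = rescale * (mu q (real s + a) - c3 q)"
  proof -
    have "q powr (a + 1) * (q powr (real s + a) + q powr (- (real s + a) - 1))
      = q powr (2 * a + (real s + 1)) + q powr (- real s)"
      unfolding distrib_left powr_add[symmetric] by (simp add: add_ac)
    also have "\<dots> = dqHahn_x q \<gamma> \<delta> (real s)"
      unfolding powr_add[of q "2 * a"] a by (simp add: dqHahn_x_def)
    finally show ?thesis using c1 by (simp add: mu_eq[OF q(1)])
  qed
  have pr: "(?C n / ?C (n - 1)) * prev (\<lambda>m. ?C m * ?u m) n = ?C n * prev ?u n"
    using norm_C_nonzero by (cases n) (simp_all add: prev_def)
  have "rescale * ?C n * ((mu q (real s + a) - c3 q) * ?u n)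
    = rescale * ?C n * ?u (n + 1) + rescale * ?C n * ((qRacah_beta q a b \<alpha> \<beta> n - c3 q) * ?u n)
      + rescale * qRacah_gamma q a b \<alpha> \<beta> n * ((?C n / ?C (n - 1)) * prev (\<lambda>m. ?C m * ?u m) n)"
    using scaled_qRacah_recurrence[OF assms, of s] unfolding x Suc_eq_plus1[symmetric] norm_C_Suc
    by (simp only: mult_ac)
  also have "\<dots> = rescale * ?C n * (?u (n + 1) + (qRacah_beta q a b \<alpha> \<beta> n - c3 q) * ?u n
      + qRacah_gamma q a b \<alpha> \<beta> n * prev ?u n)"
    unfolding pr by (simp only: distrib_left mult_ac)
  finally have "(mu q (real s + a) - c3 q) * ?u n = ?u (n + 1)
      + (qRacah_beta q a b \<alpha> \<beta> n - c3 q) * ?u n + qRacah_gamma q a b \<alpha> \<beta> n * prev ?u n"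
    using r0 norm_C_nonzero[of n] by (simp only: mult_cancel_left mult_eq_0_iff) blast
  then show ?thesis by (simp add: algebra_simps)
qed

subsection \<open>The limit \<open>\<alpha> \<rightarrow> \<infinity>\<close>\<close>

lemma powr_alpha_tendsto_0: "((\<lambda>\<alpha>. q powr \<alpha>) \<longlongrightarrow> 0) at_top"
proof -
  have "filterlim (\<lambda>\<alpha>. ln q * \<alpha>) at_bot at_top"
    using q by (intro filterlim_tendsto_neg_mult_at_bot[OF tendsto_const _ filterlim_ident]) auto
  then have "((\<lambda>\<alpha>. exp (ln q * \<alpha>)) \<longlongrightarrow> 0) at_top"
    by (rule filterlim_compose[OF exp_at_bot])
  then show ?thesis using q by (simp add: powr_def mult.commute)
qed

lemma D_tendsto_0: "(D \<longlongrightarrow> 0) at_top" and E_tendsto_0: "(E \<longlongrightarrow> 0) at_top"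
  by (intro tendsto_mult_right_zero powr_alpha_tendsto_0)+

lemma eventually_small: "\<forall>\<^sub>F \<alpha> in at_top. E \<alpha> < q \<and> D \<alpha> < 1"
  using order_tendstoD(2)[OF E_tendsto_0 q(1)] order_tendstoD(2)[OF D_tendsto_0 zero_less_one]
  by (rule eventually_conj)

lemma racah_up_tendsto:
  "((\<lambda>\<alpha>. racah_up q A B (D \<alpha>) (E \<alpha>) n) \<longlongrightarrow> (1 - A * q ^ n) * (1 - B * q ^ n)) at_top"
  unfolding racah_up_def
  by (rule tendsto_eq_intros D_tendsto_0 E_tendsto_0 refl | simp)+

lemma racah_down_tendsto:
  "((\<lambda>\<alpha>. racah_down q A B (D \<alpha>) (E \<alpha>) n)
     \<longlongrightarrow> \<gamma> * q * (1 - q ^ n) * (\<delta> - q ^ n / q ^ (N + 1))) at_top"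
proof -
  have q0: "q \<noteq> 0" "\<gamma> \<noteq> 0" "\<delta> \<noteq> 0" "q powr \<alpha> \<noteq> 0" for \<alpha> using q parameters_pos by auto
  \<comment> \<open>Numerators and denominators that both tend to zero are cancelled first:
    \<open>q powr \<alpha>\<close> drops out of the prefactor and of the quotient of
    \<open>E\<close> by \<open>D\<close>.\<close>
  have eq: "racah_down q A B (D \<alpha>) (E \<alpha>) n = \<gamma> * \<delta> * q * (1 - q ^ n) * (1 - E \<alpha> * q ^ n / A)
      * (1 - E \<alpha> * q ^ n / B) * (1 - q ^ n / (\<delta> * q ^ (N + 1)))
      / ((1 - E \<alpha> * q ^ (2 * n) / q) * (1 - E \<alpha> * q ^ (2 * n)))" for \<alpha>
  proof -
    have "A * B * D \<alpha> / (E \<alpha> * q) = \<gamma> * \<delta> * q" "E \<alpha> * q ^ n / D \<alpha> = q ^ n / (\<delta> * q ^ (N + 1))"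
      using q0 by (simp_all add: power_add power2_eq_square)
    then show ?thesis unfolding racah_down_def by metis
  qed
  \<comment> \<open>The limit is written as \<open>eq\<close> with \<open>0\<close> for
    \<open>E \<alpha>\<close>, so that the limit rules match it factor by factor.\<close>
  have lim: "\<gamma> * q * (1 - q ^ n) * (\<delta> - q ^ n / q ^ (N + 1))
      = \<gamma> * \<delta> * q * (1 - q ^ n) * (1 - 0 * q ^ n / A)
      * (1 - 0 * q ^ n / B) * (1 - q ^ n / (\<delta> * q ^ (N + 1)))
      / ((1 - 0 * q ^ (2 * n) / q) * (1 - 0 * q ^ (2 * n)))"
    using q0 by (simp add: field_simps)
  show ?thesis
    unfolding eq lim using q0 by (intro tendsto_intros E_tendsto_0) auto
qed

lemma powr_minus_N:
  "q powr (real n - real N) = A * q ^ n" "q powr (real n - real N - 1) = q ^ n / q ^ (N + 1)"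
  using q by (simp_all add: powr_diff powr_realpow)

lemma scaled_qRacah_beta_tendsto:
  "((\<lambda>\<alpha>. rescale * (qRacah_beta q a b \<alpha> \<beta> n - c3 q)) \<longlongrightarrow> dqHahn_beta q \<gamma> \<delta> N n) at_top"
proof -
  have "dqHahn_beta q \<gamma> \<delta> N n = 1 + \<gamma> * \<delta> * q - (1 - A * q ^ n) * (1 - B * q ^ n)
      - \<gamma> * q * (1 - q ^ n) * (\<delta> - q ^ n / q ^ (N + 1))"
    unfolding dqHahn_beta_def powr_minus_N by (simp add: mult_ac)
  then show ?thesis
    unfolding scaled_qRacah_beta
    by (simp only:) (intro tendsto_intros racah_up_tendsto racah_down_tendsto)
qed

lemma scaled_qRacah_gamma_tendsto:
  assumes "1 \<le> n"
  shows "((\<lambda>\<alpha>. rescale * (norm_C q \<gamma> \<delta> n / norm_C q \<gamma> \<delta> (n - 1)) * qRacah_gamma q a b \<alpha> \<beta> n)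
     \<longlongrightarrow> dqHahn_gamma q \<gamma> \<delta> N n) at_top"
proof -
  obtain m where n: "n = Suc m" using assms by (cases n) auto
  have "dqHahn_gamma q \<gamma> \<delta> N n = (1 - A * q ^ (n - 1)) * (1 - B * q ^ (n - 1))
      * (\<gamma> * q * (1 - q ^ n) * (\<delta> - q ^ n / q ^ (N + 1)))"
    unfolding dqHahn_gamma_def powr_minus_N using q by (simp add: n mult_ac)
  then show ?thesis
    unfolding scaled_qRacah_gamma[OF assms]
    by (simp only:) (intro tendsto_intros racah_up_tendsto racah_down_tendsto)
qed

lemma qpoch_tendsto_1: "(f \<longlongrightarrow> 0) F \<Longrightarrow> ((\<lambda>x. qpoch (f x) q k) \<longlongrightarrow> 1) F"
  unfolding qpoch_def by (rule tendsto_eq_intros refl | assumption | simp)+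

text \<open>The sum is finite, so the limit is taken termwise; every shifted factorial in
  \<open>D\<close> or \<open>E\<close> tends to \<open>1\<close>, which leaves the 3-phi-2
  series.\<close>

lemma scaled_qRacah_tendsto:
  "((\<lambda>\<alpha>. norm_C q \<gamma> \<delta> n * qRacah q a b \<alpha> \<beta> n (real s + a))
     \<longlongrightarrow> dqHahn q \<gamma> \<delta> N n (real s)) at_top"
proof -
  have q0: "q \<noteq> 0" using q by simp
  have Eq: "((\<lambda>\<alpha>. qpoch (E \<alpha> * q ^ n) q k) \<longlongrightarrow> 1) at_top" for k
    by (intro qpoch_tendsto_1 tendsto_mult_left_zero E_tendsto_0)
  have Dq: "((\<lambda>\<alpha>. qpoch (D \<alpha>) q k) \<longlongrightarrow> 1) at_top" for k
    by (intro qpoch_tendsto_1 D_tendsto_0)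
  have x: "q powr (real s + 1) = q ^ (s + 1)"
    using q powr_realpow[of q "s + 1"] by (simp add: add.commute)
  have lead: "((\<lambda>\<alpha>. racah_lead q A B (D \<alpha>) (E \<alpha>) n) \<longlongrightarrow> qpoch A q n * qpoch B q n * 1 / 1) at_top"
    unfolding racah_lead_def by (intro tendsto_intros Eq Dq) simp
  have term': "((\<lambda>\<alpha>. racah_term q A B (D \<alpha>) (E \<alpha>) n k)
      \<longlongrightarrow> qpoch (1 / q ^ n) q k * 1 / (qpoch A q k * qpoch B q k * 1 * qpoch q q k) * q ^ k) at_top" for k
  proof -
    \<comment> \<open>\<open>qpoch A q k\<close> or \<open>qpoch B q k\<close> may be zero here.
      Their \<open>inverse\<close> is a constant factor even then, so the quotient rule is applied
      to \<open>qpoch (D \<alpha>) q k\<close> alone.\<close>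
    have "racah_term q A B (D \<alpha>) (E \<alpha>) n k = qpoch (1 / q ^ n) q k * qpoch (E \<alpha> * q ^ n) q k
       / qpoch (D \<alpha>) q k * inverse (qpoch A q k * qpoch B q k * qpoch q q k) * q ^ k" for \<alpha>
      by (simp add: racah_term_def field_simps)
    moreover have "((\<lambda>\<alpha>. qpoch (1 / q ^ n) q k * qpoch (E \<alpha> * q ^ n) q k
       / qpoch (D \<alpha>) q k * inverse (qpoch A q k * qpoch B q k * qpoch q q k) * q ^ k)
      \<longlongrightarrow> qpoch (1 / q ^ n) q k * 1 / 1 * inverse (qpoch A q k * qpoch B q k * qpoch q q k) * q ^ k) at_top"
      by (intro tendsto_mult tendsto_divide Eq Dq tendsto_const) simp
    ultimately show ?thesis by (simp add: field_simps)
  qed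
  have "dqHahn q \<gamma> \<delta> N n (real s) = qpoch A q n * qpoch B q n * 1 / 1
      * (\<Sum>k\<le>n. qpoch (1 / q ^ n) q k * 1 / (qpoch A q k * qpoch B q k * 1 * qpoch q q k) * q ^ k
        * lattice_basis s k)"
    unfolding dqHahn_def powr_minus_real_nat[OF q(1)] x basic_hypergeom_terminating[OF q0]
    by (simp add: qpochs_def mult_ac)
  then show ?thesis
    unfolding scaled_qRacah
    by (simp only:) (intro tendsto_mult tendsto_sum lead term' tendsto_const)
qed

text \<open>The two sides of the rescaled q-Racah recurrence agree for large \<alpha>, so their
  limits coincide.\<close>

lemma dqHahn_recurrence:
  assumes \<gamma>: "\<gamma> * q < 1 \<or> \<gamma> > q powr (- real N)" and n: "n < N"
  shows "dqHahn_x q \<gamma> \<delta> (real s) * dqHahn q \<gamma> \<delta> N n (real s)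
     = dqHahn q \<gamma> \<delta> N (n + 1) (real s)
       + dqHahn_beta q \<gamma> \<delta> N n * dqHahn q \<gamma> \<delta> N n (real s)
       + dqHahn_gamma q \<gamma> \<delta> N n * prev (\<lambda>m. dqHahn q \<gamma> \<delta> N m (real s)) n"
proof -
  let ?S = "\<lambda>m \<alpha>. norm_C q \<gamma> \<delta> m * qRacah q a b \<alpha> \<beta> m (real s + a)"
  have S: "(?S m \<longlongrightarrow> dqHahn q \<gamma> \<delta> N m (real s)) at_top" for m
    by (rule scaled_qRacah_tendsto)
  let ?g = "\<lambda>\<alpha>. rescale * (norm_C q \<gamma> \<delta> n / norm_C q \<gamma> \<delta> (n - 1)) * qRacah_gamma q a b \<alpha> \<beta> n"
  let ?R = "\<lambda>\<alpha>. ?S (n + 1) \<alpha> + rescale * (qRacah_beta q a b \<alpha> \<beta> n - c3 q) * ?S n \<alpha>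
      + ?g \<alpha> * prev (\<lambda>m. ?S m \<alpha>) n"
  \<comment> \<open>The limit of the last coefficient is available for \<open>1 \<le> n\<close>; at
    \<open>n = 0\<close> the convention in \<open>prev\<close> makes the product zero.\<close>
  have "((\<lambda>\<alpha>. ?g \<alpha> * prev (\<lambda>m. ?S m \<alpha>) n)
      \<longlongrightarrow> dqHahn_gamma q \<gamma> \<delta> N n * prev (\<lambda>m. dqHahn q \<gamma> \<delta> N m (real s)) n) at_top"
  proof (cases n)
    case 0
    then show ?thesis by (simp add: prev_def)
  next
    case (Suc m)
    have "((\<lambda>\<alpha>. ?g \<alpha> * ?S m \<alpha>)
      \<longlongrightarrow> dqHahn_gamma q \<gamma> \<delta> N n * dqHahn q \<gamma> \<delta> N m (real s)) at_top"
      using Suc by (intro tendsto_mult scaled_qRacah_gamma_tendsto S) auto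
    then show ?thesis by (simp add: Suc prev_def)
  qed
  then have "(?R \<longlongrightarrow> dqHahn q \<gamma> \<delta> N (n + 1) (real s)
       + dqHahn_beta q \<gamma> \<delta> N n * dqHahn q \<gamma> \<delta> N n (real s)
       + dqHahn_gamma q \<gamma> \<delta> N n * prev (\<lambda>m. dqHahn q \<gamma> \<delta> N m (real s)) n) at_top"
    by (rule tendsto_add[OF tendsto_add[OF S
      tendsto_mult[OF scaled_qRacah_beta_tendsto S]]])
  moreover have "(?R \<longlongrightarrow> dqHahn_x q \<gamma> \<delta> (real s) * dqHahn q \<gamma> \<delta> N n (real s)) at_top"
  proof (rule Lim_transform_eventually)
    show "((\<lambda>\<alpha>. dqHahn_x q \<gamma> \<delta> (real s) * ?S n \<alpha>)
        \<longlongrightarrow> dqHahn_x q \<gamma> \<delta> (real s) * dqHahn q \<gamma> \<delta> N n (real s)) at_top"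
      by (intro tendsto_mult tendsto_const S)
    show "\<forall>\<^sub>F \<alpha> in at_top. dqHahn_x q \<gamma> \<delta> (real s) * ?S n \<alpha> = ?R \<alpha>"
      using eventually_small
      by eventually_elim (use scaled_qRacah_recurrence[OF \<gamma> _ _ n] in blast)
  qed
  ultimately show ?thesis
    using tendsto_unique[OF trivial_limit_at_top_linorder] by blast
qed

end

theorem mainTheorem4:
  fixes q \<gamma> \<delta> a b \<beta> :: real and N :: nat
  assumes "0 < q" and "q < 1" and "N \<ge> 1"
    and "(0 < \<gamma> * q \<and> \<gamma> * q < 1 \<and> 0 < \<delta> * q \<and> \<delta> * q < 1)
         \<or> (\<gamma> > q powr (- real N) \<and> \<delta> > q powr (- real N))"
    and "b - a = real N + 1" and "q powr \<beta> = \<gamma>" and "q powr (2 * a) = \<gamma> * \<delta>"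
  shows
    "(\<forall>n<N. ((\<lambda>\<alpha>. q powr (a + 1) / c1 q * (qRacah_beta q a b \<alpha> \<beta> n - c3 q))
         \<longlongrightarrow> dqHahn_beta q \<gamma> \<delta> N n) at_top)
     \<and> (\<forall>n. 1 \<le> n \<and> n < N \<longrightarrow>
         ((\<lambda>\<alpha>. q powr (a + 1) / c1 q * (norm_C q \<gamma> \<delta> n / norm_C q \<gamma> \<delta> (n - 1))
                * qRacah_gamma q a b \<alpha> \<beta> n)
         \<longlongrightarrow> dqHahn_gamma q \<gamma> \<delta> N n) at_top)
     \<and> (\<forall>n<N. \<forall>s\<le>N.
         (\<forall>\<^sub>F \<alpha> in at_top.
            mu q (real s + a) * qRacah q a b \<alpha> \<beta> n (real s + a)
            = qRacah q a b \<alpha> \<beta> (n + 1) (real s + a)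
              + qRacah_beta q a b \<alpha> \<beta> n * qRacah q a b \<alpha> \<beta> n (real s + a)
              + qRacah_gamma q a b \<alpha> \<beta> n * prev (\<lambda>m. qRacah q a b \<alpha> \<beta> m (real s + a)) n)
       \<and> (\<forall>\<^sub>F \<alpha> in at_top.
            dqHahn_x q \<gamma> \<delta> (real s) * (norm_C q \<gamma> \<delta> n * qRacah q a b \<alpha> \<beta> n (real s + a))
            = norm_C q \<gamma> \<delta> (n + 1) * qRacah q a b \<alpha> \<beta> (n + 1) (real s + a)
              + q powr (a + 1) / c1 q * (qRacah_beta q a b \<alpha> \<beta> n - c3 q)
                * (norm_C q \<gamma> \<delta> n * qRacah q a b \<alpha> \<beta> n (real s + a))
              + q powr (a + 1) / c1 q * (norm_C q \<gamma> \<delta> n / norm_C q \<gamma> \<delta> (n - 1))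
                * qRacah_gamma q a b \<alpha> \<beta> n
                * prev (\<lambda>m. norm_C q \<gamma> \<delta> m * qRacah q a b \<alpha> \<beta> m (real s + a)) n)
       \<and> dqHahn_x q \<gamma> \<delta> (real s) * dqHahn q \<gamma> \<delta> N n (real s)
         = dqHahn q \<gamma> \<delta> N (n + 1) (real s)
           + dqHahn_beta q \<gamma> \<delta> N n * dqHahn q \<gamma> \<delta> N n (real s)
           + dqHahn_gamma q \<gamma> \<delta> N n * prev (\<lambda>m. dqHahn q \<gamma> \<delta> N m (real s)) n)
     \<and> (\<forall>n\<le>N. \<forall>s\<le>N.
         ((\<lambda>\<alpha>. norm_C q \<gamma> \<delta> n * qRacah q a b \<alpha> \<beta> n (real s + a))
         \<longlongrightarrow> dqHahn q \<gamma> \<delta> N n (real s)) at_top)"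
proof -
  have b: "b = a + real N + 1" using assms(5) by simp
  \<comment> \<open>Each parameter regime contains one of the two alternatives treated in
    \<open>qpoch_B_nonzero\<close>.\<close>
  have \<gamma>: "\<gamma> * q < 1 \<or> \<gamma> > q powr (- real N)" using assms(4) by blast
  note params = assms(1,2) b assms(6,7)
  note small = eventually_small[OF params]
  show ?thesis
  proof (intro conjI allI impI, goal_cases)
    case (1 n)
    show ?case by (rule scaled_qRacah_beta_tendsto[OF params])
  next
    case (2 n)
    then show ?case by (intro scaled_qRacah_gamma_tendsto[OF params]) simp
  next
    case (3 n s)
    then show ?case
      by (intro eventually_mono[OF small] qRacah_recurrence[OF params \<gamma>]) auto
  next
    case (4 n s)
    then show ?case
      by (intro eventually_mono[OF small] scaled_qRacah_recurrence[OF params \<gamma>]) auto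
  next
    case (5 n s)
    then show ?case by (intro dqHahn_recurrence[OF params \<gamma>])
  next
    case (6 n s)
    show ?case by (rule scaled_qRacah_tendsto[OF params])
  qed
qed

end
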